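(* Let $(2,b,c)$ be a Markoff triple with $c$ odd, $c>1$ and $b\le c$. Let $D=9c^2-4$, $\omega=\frac{1+\sqrt D}{2}$, let $k$ be the integer with $2k\equiv b\pmod c$, $0\le k<c$, and let $\mathcal{I}_c=\mathbb{Z}c+\mathbb{Z}\left(k+\tfrac{c-1}{2}+\omega\right)$, $\Lambda_c=\psi(\mathcal{I}_c)$. For $i=1,2$ let $$\beta_i=\left\lfloor\frac{-k\mp\sqrt{3c^2/2-1}}{c}\right\rfloor\quad(\text{minus sign for }i=1),\qquad B_i=\left\{c,\ \beta_ic+k+\tfrac{c-1}{2}+\omega\right\}.$$ Then $\beta_1=-2$ and $\beta_2=0$, so $B_1=\{c,-2c+k+\frac{c-1}{2}+\omega\}$ and $B_2=\{c,k+\frac{c-1}{2}+\omega\}$; both are good for twisting, and the cosines $\cos\theta_i$ of the minimal angles of the corresponding well-rounded twists satisfy $\lim_{c\to\infty}\cos\theta_1=\frac{3-\sqrt2}{7}$ and $\lim_{c\to\infty}\cos\theta_2=\frac{15-11\sqrt2}{17}$ (limits over such triples). Furthermore, there are infinitely many Markoff triples of the form $(2,b,c)$ with $c$ odd; such triples are given by $(2,P_{2n-2},P_{2n})$, $n\ge2$, where $P_{2n}$ is an even-indexed Pell number.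
   Context: A Markoff triple is a triple $(a,b,c)$ of nonnegative integers with $a^2+b^2+c^2=3abc$. Pell numbers: $P_1=0$, $P_2=1$, $P_n=2P_{n-1}+P_{n-2}$. For $z=u+v\sqrt D$ ($u,v\in\mathbb{Q}$) put $\bar z=u-v\sqrt D$ and $\psi(z)=(z,\bar z)\in\mathbb{R}^2$. For $\alpha>0$, $T_\alpha=\mathrm{diag}(\alpha,1/\alpha)$. A basis $\{u,v\}$ of a planar lattice is minimal if $\|u\|=\|v\|$ and $|\langle u,v\rangle|\le\frac12\|u\|\|v\|$. A basis $\{x,y\}$ of $\mathcal{I}_c$ is good for twisting if there is $\alpha>0$ with $T_\alpha\Lambda_c$ well-rounded and $\{T_\alpha\psi(x),T_\alpha\psi(y)\}$ a minimal basis; then $\cos\theta$ denotes the cosine of the angle between $T_\alpha\psi(x)$ and $T_\alpha\psi(y)$, which equals $(x\bar x+y\bar y)/(x\bar y+\bar x y)$. *)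

theory Defs
  imports "HOL-Analysis.Analysis" "HOL-Number_Theory.Number_Theory"
begin

definition markoff_triple :: "nat \<Rightarrow> nat \<Rightarrow> nat \<Rightarrow> bool" where
  "markoff_triple a b c \<longleftrightarrow> a\<^sup>2 + b\<^sup>2 + c\<^sup>2 = 3 * a * b * c"

text \<open>The numbering starts with \<open>P\<^sub>1 = 0\<close>, \<open>P\<^sub>2 = 1\<close>; the value
  \<open>P\<^sub>0 = 1\<close> is the backward extension of the recurrence.\<close>

fun pell :: "nat \<Rightarrow> nat" where
  "pell 0 = 1"
| "pell (Suc 0) = 0"
| "pell (Suc (Suc n)) = 2 * pell (Suc n) + pell n"


text \<open>Elements of \<open>\<rat>(\<surd>D)\<close> are real numbers. The conjugate is well defined as
  soon as \<open>\<surd>D\<close> is irrational, see \<open>quad_conj_eq\<close> below.\<close>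

definition quad_conj :: "int \<Rightarrow> real \<Rightarrow> real" where
  "quad_conj D z = (THE w. \<exists>u\<in>\<rat>. \<exists>v\<in>\<rat>.
     z = u + v * sqrt (of_int D) \<and> w = u - v * sqrt (of_int D))"

definition psi :: "int \<Rightarrow> real \<Rightarrow> real \<times> real" where
  "psi D z = (z, quad_conj D z)"

definition twist :: "real \<Rightarrow> real \<times> real \<Rightarrow> real \<times> real" where
  "twist \<alpha> p = (\<alpha> * fst p, 1 / \<alpha> * snd p)"

definition int_span :: "'a::real_vector \<Rightarrow> 'a \<Rightarrow> 'a set" where
  "int_span u v = {of_int m *\<^sub>R u + of_int n *\<^sub>R v | m n :: int. True}"

definition int_basis :: "'a::real_vector set \<Rightarrow> 'a \<Rightarrow> 'a \<Rightarrow> bool" where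
  "int_basis L u v \<longleftrightarrow> L = int_span u v \<and>
     (\<forall>m n :: int. of_int m *\<^sub>R u + of_int n *\<^sub>R v = 0 \<longrightarrow> m = 0 \<and> n = 0)"

definition min_vectors :: "'a::euclidean_space set \<Rightarrow> 'a set" where
  "min_vectors L = {v \<in> L. v \<noteq> 0 \<and> (\<forall>w\<in>L. w \<noteq> 0 \<longrightarrow> norm v \<le> norm w)}"

definition well_rounded :: "'a::euclidean_space set \<Rightarrow> bool" where
  "well_rounded L \<longleftrightarrow> span (min_vectors L) = UNIV"

text \<open>The two norm conditions force \<open>u\<close> and \<open>v\<close> to be linearly independent over
  the reals, so a set with a minimal basis is a full planar lattice.\<close>

definition minimal_basis :: "(real \<times> real) set \<Rightarrow> real \<times> real \<Rightarrow> real \<times> real \<Rightarrow> bool" where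
  "minimal_basis L u v \<longleftrightarrow> int_basis L u v \<and>
     norm u = norm v \<and> \<bar>u \<bullet> v\<bar> \<le> 1 / 2 * norm u * norm v"

definition cos_angle :: "'a::real_inner \<Rightarrow> 'a \<Rightarrow> real" where
  "cos_angle u v = (u \<bullet> v) / (norm u * norm v)"

definition twists_by :: "int \<Rightarrow> real set \<Rightarrow> real \<Rightarrow> real \<Rightarrow> real \<Rightarrow> bool" where
  "twists_by D I x y \<alpha> \<longleftrightarrow> \<alpha> > 0 \<and> well_rounded (twist \<alpha> ` psi D ` I) \<and>
     minimal_basis (twist \<alpha> ` psi D ` I) (twist \<alpha> (psi D x)) (twist \<alpha> (psi D y))"

definition good_for_twisting :: "int \<Rightarrow> real set \<Rightarrow> real set \<Rightarrow> bool" where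
  "good_for_twisting D I B \<longleftrightarrow>
     (\<exists>x y. B = {x, y} \<and> int_basis I x y \<and> (\<exists>\<alpha>. twists_by D I x y \<alpha>))"

text \<open>The value does not depend on the choice of \<open>\<alpha>\<close> nor on the order of the
  basis vectors, see \<open>cos_theta_eq\<close> below.\<close>

definition cos_theta :: "int \<Rightarrow> real set \<Rightarrow> real set \<Rightarrow> real" where
  "cos_theta D I B = (THE t. \<exists>x y \<alpha>. B = {x, y} \<and> int_basis I x y \<and> twists_by D I x y \<alpha> \<and>
     t = cos_angle (twist \<alpha> (psi D x)) (twist \<alpha> (psi D y)))"


definition markoff_disc :: "nat \<Rightarrow> int" where
  "markoff_disc c = 9 * (int c)\<^sup>2 - 4"

definition markoff_omega :: "nat \<Rightarrow> real" where
  "markoff_omega c = (1 + sqrt (of_int (markoff_disc c))) / 2"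

definition markoff_k :: "nat \<Rightarrow> nat \<Rightarrow> int" where
  "markoff_k b c = (THE k. [2 * k = int b] (mod int c) \<and> 0 \<le> k \<and> k < int c)"

definition markoff_gen :: "nat \<Rightarrow> nat \<Rightarrow> real" where
  "markoff_gen b c = of_int (markoff_k b c) + (real c - 1) / 2 + markoff_omega c"

definition markoff_module :: "nat \<Rightarrow> nat \<Rightarrow> real set" where
  "markoff_module b c = int_span (real c) (markoff_gen b c)"

definition beta1 :: "nat \<Rightarrow> nat \<Rightarrow> int" where
  "beta1 b c = \<lfloor>(- of_int (markoff_k b c) - sqrt (3 * (real c)\<^sup>2 / 2 - 1)) / real c\<rfloor>"

definition beta2 :: "nat \<Rightarrow> nat \<Rightarrow> int" where
  "beta2 b c = \<lfloor>(- of_int (markoff_k b c) + sqrt (3 * (real c)\<^sup>2 / 2 - 1)) / real c\<rfloor>"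

definition basis1 :: "nat \<Rightarrow> nat \<Rightarrow> real set" where
  "basis1 b c = {real c, of_int (beta1 b c) * real c + markoff_gen b c}"

definition basis2 :: "nat \<Rightarrow> nat \<Rightarrow> real set" where
  "basis2 b c = {real c, of_int (beta2 b c) * real c + markoff_gen b c}"

definition admissible_pairs :: "(nat \<times> nat) set" where
  "admissible_pairs = {(b, c). markoff_triple 2 b c \<and> odd c \<and> c > 1 \<and> b \<le> c}"


lemma quad_conj_eq:
  assumes "sqrt (of_int D) \<notin> \<rat>" "u \<in> \<rat>" "v \<in> \<rat>"
  shows "quad_conj D (u + v * sqrt (of_int D)) = u - v * sqrt (of_int D)"
  unfolding quad_conj_def
proof (rule the_equality)
  fix w
  assume "\<exists>u'\<in>\<rat>. \<exists>v'\<in>\<rat>. u + v * sqrt (of_int D) = u' + v' * sqrt (of_int D) \<and>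
            w = u' - v' * sqrt (of_int D)"
  then obtain u' v' where *: "u' \<in> \<rat>" "v' \<in> \<rat>"
    "u + v * sqrt (of_int D) = u' + v' * sqrt (of_int D)" "w = u' - v' * sqrt (of_int D)"
    by blast
  have "v = v'"
  proof (rule ccontr)
    assume "v \<noteq> v'"
    then have "sqrt (of_int D) = (u' - u) / (v - v')"
      using *(3) by (simp add: field_simps)
    also have "\<dots> \<in> \<rat>" using assms * by (intro Rats_divide Rats_diff)
    finally show False using assms(1) by simp
  qed
  then show "w = u - v * sqrt (of_int D)" using * by simp
qed (use assms in blast)

lemma markoff_k_unique:
  assumes "odd c"
  shows "\<exists>!k. [2 * k = int b] (mod int c) \<and> 0 \<le> k \<and> k < int c"
proof -
  have c: "coprime (2::int) (int c)" "0 < int c" using assms by (auto intro: Nat.gr0I)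
  obtain x where x: "[2 * x = 1] (mod int c)"
    using cong_solve_coprime_int[OF c(1)] by blast
  have "[2 * ((x * int b) mod int c) = int b] (mod int c)"
    using cong_scalar_right[OF x, of "int b"]
    by (simp add: cong_def mod_mult_right_eq mult.assoc)
  moreover have "k = l" if "[2 * k = int b] (mod int c)" "[2 * l = int b] (mod int c)"
    "0 \<le> k" "k < int c" "0 \<le> l" "l < int c" for k l
  proof -
    have "[k = l] (mod int c)"
      using that(1,2) c(1) by (meson cong_mult_lcancel cong_sym cong_trans)
    then show ?thesis using that by (simp add: cong_def)
  qed
  ultimately show ?thesis using c(2) by (metis pos_mod_bound pos_mod_sign)
qed

lemma cos_angle_twist:
  assumes D: "sqrt (of_int D) \<notin> \<rat>"
    and I: "I \<subseteq> {u + v * sqrt (of_int D) | u v. u \<in> \<rat> \<and> v \<in> \<rat>}"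
    and B: "int_basis I x y" "twists_by D I x y \<alpha>"
  shows "cos_angle (twist \<alpha> (psi D x)) (twist \<alpha> (psi D y)) =
    (x * quad_conj D x + y * quad_conj D y) / (x * quad_conj D y + quad_conj D x * y)"
proof -
  define x' y' where "x' = quad_conj D x" and "y' = quad_conj D y"
  have \<alpha>: "\<alpha> > 0" using B(2) by (simp add: twists_by_def)
  have ind: "m = 0 \<and> n = 0" if "of_int m * x + of_int n * y = 0" for m n :: int
    using B(1) that unfolding int_basis_def by simp
  have I_eq: "I = int_span x y" using B(1) by (simp add: int_basis_def)
  have "x = of_int 1 *\<^sub>R x + of_int 0 *\<^sub>R y" "y = of_int 0 *\<^sub>R x + of_int 1 *\<^sub>R y" by simp_all
  then have xI: "x \<in> I" and yI: "y \<in> I" unfolding I_eq int_span_def by blast+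
  have xy: "x \<noteq> 0" "y \<noteq> 0" "x \<noteq> y" "x \<noteq> - y"
    using ind[of 1 0] ind[of 0 1] ind[of 1 "-1"] ind[of 1 1] by auto
  have conj0: "quad_conj D z \<noteq> 0" if "z \<in> I" "z \<noteq> 0" for z
  proof
    assume 0: "quad_conj D z = 0"
    obtain u v where uv: "u \<in> \<rat>" "v \<in> \<rat>" "z = u + v * sqrt (of_int D)" using I \<open>z \<in> I\<close> by blast
    have eq: "u = v * sqrt (of_int D)" using 0 quad_conj_eq[OF D uv(1,2)] uv(3) by simp
    have "v = 0"
    proof (rule ccontr)
      assume "v \<noteq> 0"
      then have "sqrt (of_int D) = u / v" using eq by simp
      then show False using D uv by (metis Rats_divide)
    qed
    then show False using eq uv(3) \<open>z \<noteq> 0\<close> by simp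
  qed
  have nz: "x' \<noteq> 0" "y' \<noteq> 0" using conj0 xI yI xy by (auto simp: x'_def y'_def)
  define N where "N = (\<alpha> * x)\<^sup>2 + (x' / \<alpha>)\<^sup>2"
  have norm_x: "norm (twist \<alpha> (psi D x)) = sqrt N"
    by (simp add: twist_def psi_def norm_Pair power_divide N_def x'_def)
  have norm_y: "norm (twist \<alpha> (psi D y)) = sqrt ((\<alpha> * y)\<^sup>2 + (y' / \<alpha>)\<^sup>2)"
    by (simp add: twist_def psi_def norm_Pair power_divide y'_def)
  have norms: "norm (twist \<alpha> (psi D x)) = norm (twist \<alpha> (psi D y))"
    using B(2) by (simp add: twists_by_def minimal_basis_def)
  have N2: "N = (\<alpha> * y)\<^sup>2 + (y' / \<alpha>)\<^sup>2" using norms norm_x norm_y by simp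
  have N0: "N > 0" unfolding N_def using \<alpha> xy(1) by (intro add_pos_nonneg) auto
  define P where "P = \<alpha>\<^sup>2 * x * y + x' * y' / \<alpha>\<^sup>2"
  have inner: "twist \<alpha> (psi D x) \<bullet> twist \<alpha> (psi D y) = P"
    by (simp add: twist_def psi_def P_def x'_def y'_def power2_eq_square)
  have "norm (twist \<alpha> (psi D x)) * norm (twist \<alpha> (psi D y)) = N"
    unfolding norms[symmetric] norm_x using N0 by simp
  then have lhs: "cos_angle (twist \<alpha> (psi D x)) (twist \<alpha> (psi D y)) = P / N"
    by (simp add: cos_angle_def inner)
  have "P * (x * y' + x' * y) = y * y' * N + x * x' * N"
    unfolding P_def by (subst N_def, subst N2) (use \<alpha> in \<open>simp add: field_simps power2_eq_square\<close>)
  then have key: "P * (x * y' + x' * y) = (x * x' + y * y') * N" by (simp add: algebra_simps)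
  have "x * y' + x' * y \<noteq> 0"
  proof
    assume 0: "x * y' + x' * y = 0"
    then have 1: "x * x' + y * y' = 0" using key N0 by simp
    have "x' * (x\<^sup>2 - y\<^sup>2) = x * (x * x' + y * y') - y * (x * y' + x' * y)"
      by (simp add: algebra_simps power2_eq_square)
    then have "x\<^sup>2 = y\<^sup>2" using 0 1 nz by simp
    then show False using xy by (simp add: power2_eq_iff)
  qed
  then have "P / N = (x * x' + y * y') / (x * y' + x' * y)"
    using key N0 by (simp add: frac_eq_eq)
  then show ?thesis using lhs by (simp add: x'_def y'_def)
qed

lemma cos_theta_eq:
  assumes D: "sqrt (of_int D) \<notin> \<rat>"
    and I: "I \<subseteq> {u + v * sqrt (of_int D) | u v. u \<in> \<rat> \<and> v \<in> \<rat>}"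
    and B: "int_basis I x y" "twists_by D I x y \<alpha>"
  shows "cos_theta D I {x, y} =
    (x * quad_conj D x + y * quad_conj D y) / (x * quad_conj D y + quad_conj D x * y)"
  unfolding cos_theta_def
proof (rule the_equality)
  show "\<exists>x' y' \<alpha>. {x, y} = {x', y'} \<and> int_basis I x' y' \<and> twists_by D I x' y' \<alpha> \<and>
    (x * quad_conj D x + y * quad_conj D y) / (x * quad_conj D y + quad_conj D x * y) =
    cos_angle (twist \<alpha> (psi D x')) (twist \<alpha> (psi D y'))"
    using cos_angle_twist[OF D I B] B by metis
next
  fix t
  assume "\<exists>x' y' \<alpha>. {x, y} = {x', y'} \<and> int_basis I x' y' \<and> twists_by D I x' y' \<alpha> \<and>
    t = cos_angle (twist \<alpha> (psi D x')) (twist \<alpha> (psi D y'))"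
  then obtain x' y' \<alpha>' where *: "{x, y} = {x', y'}" "int_basis I x' y'" "twists_by D I x' y' \<alpha>'"
    "t = cos_angle (twist \<alpha>' (psi D x')) (twist \<alpha>' (psi D y'))" by blast
  have "x' = x \<and> y' = y \<or> x' = y \<and> y' = x" using *(1) by (auto simp: doubleton_eq_iff)
  then show "t = (x * quad_conj D x + y * quad_conj D y) / (x * quad_conj D y + quad_conj D x * y)"
    using cos_angle_twist[OF D I *(2,3)] *(4) by (auto simp: algebra_simps)
qed

end

theory Submission
  imports Defs "HOL-Real_Asymp.Real_Asymp"
begin

text \<open>
  The Markoff equation gives \<open>2 k = b + c\<close> and \<open>5 b \<le> c\<close>, so that \<open>\<beta>\<^sub>1 = -2\<close>,
  \<open>\<beta>\<^sub>2 = 0\<close>, and the second basis vector is \<open>y = b/2 + J c + \<surd>D/2\<close> with \<open>J = \<beta>\<^sub>i + 1\<close>.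
  For \<open>x = c\<close>, the relation \<open>b\<^sup>2 + c\<^sup>2 + 4 = 6 b c\<close> cancels a factor \<open>c\<close> from
  \<open>(c\<^sup>2 + y y') / (c y + c y')\<close>. The cosines become \<open>(1 - r) / (2 (2 - r))\<close> and
  \<open>(5 r - 1) / (2 (2 + r))\<close> with \<open>r = b/c = 3 - \<surd>(8 c\<^sup>2 - 4) / c\<close>, which tends to \<open>3 - 2 \<surd>2\<close>.
\<close>

section \<open>Planar lattices and their integral bases\<close>

text \<open>With \<open>N\<close> the common squared length and
  \<open>\<bar>P\<bar> \<le> N / 2\<close>, the vector \<open>m u + n v\<close> has squared length
  at least \<open>(m^2 + n^2 - \<bar>m n\<bar>) N\<close>, and this integer factor is at least 1
  unless \<open>m = n = 0\<close>. Hence \<open>u\<close> and \<open>v\<close> are shortest vectors.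
  Well-roundedness of a twist therefore follows from the minimal basis alone.\<close>

lemma minimal_basis_imp_well_rounded:
  assumes "minimal_basis L u v"
  shows "well_rounded L"
proof -
  define N where "N = u \<bullet> u"
  define P where "P = u \<bullet> v"
  have basis: "int_basis L u v" and eq: "norm u = norm v"
    and bound: "\<bar>u \<bullet> v\<bar> \<le> 1 / 2 * norm u * norm v"
    using assms by (auto simp: minimal_basis_def)
  have L: "L = int_span u v"
    and ind: "\<And>m n :: int. of_int m *\<^sub>R u + of_int n *\<^sub>R v = 0 \<Longrightarrow> m = 0 \<and> n = 0"
    using basis by (auto simp: int_basis_def)
  have u0: "u \<noteq> 0" using ind[of 1 0] by auto
  have v0: "v \<noteq> 0" using ind[of 0 1] by auto
  have Nv: "v \<bullet> v = N" using eq by (simp add: N_def dot_square_norm)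
  have N0: "N > 0" using u0 by (simp add: N_def)
  have P: "\<bar>P\<bar> \<le> N / 2"
    using bound eq by (simp add: P_def N_def dot_square_norm power2_eq_square)
  have sq: "(of_int m *\<^sub>R u + of_int n *\<^sub>R v) \<bullet> (of_int m *\<^sub>R u + of_int n *\<^sub>R v)
    = of_int (m\<^sup>2 + n\<^sup>2) * N + 2 * of_int (m * n) * P" for m n :: int
    by (simp add: inner_add_left inner_add_right Nv P_def N_def inner_commute[of v u]
        power2_eq_square algebra_simps)
  have short: "N \<le> w \<bullet> w" if w_in: "w \<in> L" and w_nz: "w \<noteq> 0" for w
  proof -
    obtain m n :: int where w: "w = of_int m *\<^sub>R u + of_int n *\<^sub>R v"
      using w_in unfolding L int_span_def by blast
    have "m \<noteq> 0 \<or> n \<noteq> 0" using w w_nz by auto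
    then have "1 \<le> m\<^sup>2 + n\<^sup>2 - \<bar>m * n\<bar>"
    proof -
      have "2 * (m\<^sup>2 + n\<^sup>2 - \<bar>m * n\<bar>) = m\<^sup>2 + n\<^sup>2 + (\<bar>m\<bar> - \<bar>n\<bar>)\<^sup>2"
        by (simp add: power2_diff abs_mult)
      moreover have "m\<^sup>2 + n\<^sup>2 > 0"
        using \<open>m \<noteq> 0 \<or> n \<noteq> 0\<close> by (simp add: sum_power2_gt_zero_iff)
      moreover have "(\<bar>m\<bar> - \<bar>n\<bar>)\<^sup>2 \<ge> 0" by simp
      ultimately have "0 < 2 * (m\<^sup>2 + n\<^sup>2 - \<bar>m * n\<bar>)" by (metis add_pos_nonneg)
      then show ?thesis by simp
    qed
    then have 1: "(1::real) \<le> of_int (m\<^sup>2 + n\<^sup>2 - \<bar>m * n\<bar>)" by linarith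
    have "\<bar>2 * of_int (m * n) * P\<bar> = 2 * \<bar>of_int (m * n)\<bar> * \<bar>P\<bar>"
      by (simp add: abs_mult)
    also have "\<dots> \<le> 2 * \<bar>of_int (m * n)\<bar> * (N / 2)"
      using P by (intro mult_left_mono) auto
    finally have "- (of_int \<bar>m * n\<bar> * N) \<le> 2 * of_int (m * n) * P" by simp
    then have "of_int (m\<^sup>2 + n\<^sup>2 - \<bar>m * n\<bar>) * N \<le> w \<bullet> w"
      unfolding w sq by (simp add: algebra_simps)
    moreover have "1 * N \<le> of_int (m\<^sup>2 + n\<^sup>2 - \<bar>m * n\<bar>) * N"
      using 1 N0 by (intro mult_right_mono) auto
    ultimately show ?thesis by linarith
  qed
  have "u = of_int 1 *\<^sub>R u + of_int 0 *\<^sub>R v" "v = of_int 0 *\<^sub>R u + of_int 1 *\<^sub>R v" by simp_all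
  then have "u \<in> L" "v \<in> L" unfolding L int_span_def by blast+
  then have "u \<in> min_vectors L" "v \<in> min_vectors L"
    using short u0 v0 Nv by (auto simp: min_vectors_def norm_le N_def)
  then have span: "s *\<^sub>R u + t *\<^sub>R v \<in> span (min_vectors L)" for s t
    by (intro span_add span_scale span_base)
  \<comment> \<open>The determinant of \<open>u\<close>, \<open>v\<close>. By Lagrange's identity
    its square is the Gram determinant \<open>N^2 - P^2\<close>, which is at least
    \<open>3/4 N^2\<close>, so the two vectors span the plane.\<close>
  define d where "d = fst u * snd v - snd u * fst v"
  have "d\<^sup>2 = N * (v \<bullet> v) - P\<^sup>2"
    by (simp add: d_def N_def P_def inner_prod_def power2_eq_square algebra_simps)
  also have "\<dots> \<ge> N\<^sup>2 - (N / 2)\<^sup>2"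
    using power_mono[OF P, of 2] by (simp add: Nv power2_eq_square)
  finally have "d\<^sup>2 \<ge> 3 / 4 * N\<^sup>2" by (simp add: power2_eq_square)
  moreover have "N\<^sup>2 > 0" using N0 by simp
  ultimately have d0: "d \<noteq> 0" by auto
  have "p \<in> span (min_vectors L)" for p
  proof -
    \<comment> \<open>Cramer's rule.\<close>
    have "p = ((fst p * snd v - snd p * fst v) / d) *\<^sub>R u
      + ((fst u * snd p - snd u * fst p) / d) *\<^sub>R v"
      using d0 by (intro prod_eqI) (simp_all add: field_simps, simp_all add: d_def algebra_simps)
    then show ?thesis using span by metis
  qed
  then show ?thesis by (auto simp: well_rounded_def)
qed

text \<open>The shear is unimodular, with inverse the shear by \<open>-j\<close>. Taking
  \<open>j\<close> to be \<beta>_1 or \<beta>_2 turns the defining basis of the module into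
  \<open>B_1\<close> or \<open>B_2\<close>.\<close>

lemma int_basis_shear:
  assumes "int_basis L u v"
  shows "int_basis L u (of_int j *\<^sub>R u + v)"
proof -
  have shear: "of_int m *\<^sub>R u + of_int n *\<^sub>R (of_int j *\<^sub>R u + v)
      = of_int (m + n * j) *\<^sub>R u + of_int n *\<^sub>R v" for m n
    by (simp add: algebra_simps)
  have "int_span u (of_int j *\<^sub>R u + v) = int_span u v"
  proof (intro equalityI subsetI)
    fix w assume "w \<in> int_span u v"
    then obtain m n :: int where w: "w = of_int m *\<^sub>R u + of_int n *\<^sub>R v"
      by (auto simp: int_span_def)
    have "w = of_int (m - n * j) *\<^sub>R u + of_int n *\<^sub>R (of_int j *\<^sub>R u + v)"
      unfolding shear w by simp
    then show "w \<in> int_span u (of_int j *\<^sub>R u + v)" unfolding int_span_def by blast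
  next
    fix w assume "w \<in> int_span u (of_int j *\<^sub>R u + v)"
    then show "w \<in> int_span u v" unfolding int_span_def shear by blast
  qed
  moreover have "m = 0 \<and> n = 0"
    if "of_int m *\<^sub>R u + of_int n *\<^sub>R (of_int j *\<^sub>R u + v) = 0" for m n
    using assms that unfolding shear int_basis_def by fastforce
  ultimately show ?thesis using assms by (auto simp: int_basis_def)
qed

text \<open>Linearity is asked for on integer combinations only, because \<open>quad_conj\<close>,
  and hence \<open>psi\<close>, is meaningful only on Q(sqrt D) and not on all reals.\<close>

lemma int_span_image:
  assumes "\<And>m n :: int. f (of_int m *\<^sub>R x + of_int n *\<^sub>R y) = of_int m *\<^sub>R f x + of_int n *\<^sub>R f y"
  shows "f ` int_span x y = int_span (f x) (f y)"
proof -
  have "f ` int_span x y = {f (of_int m *\<^sub>R x + of_int n *\<^sub>R y) | m n :: int. True}"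
    unfolding int_span_def by blast
  then show ?thesis by (simp add: assms int_span_def)
qed

section \<open>Existence of twists in a real quadratic field\<close>

lemma psi_int_combination:
  assumes D: "sqrt (of_int D) \<notin> \<rat>"
    and rat: "p \<in> \<rat>" "q \<in> \<rat>" "r \<in> \<rat>" "t \<in> \<rat>"
    and x: "x = p + q * sqrt (of_int D)" and y: "y = r + t * sqrt (of_int D)"
  shows "psi D (of_int m *\<^sub>R x + of_int n *\<^sub>R y) = of_int m *\<^sub>R psi D x + of_int n *\<^sub>R psi D y"
proof -
  have eq: "of_int m *\<^sub>R x + of_int n *\<^sub>R y
    = (of_int m * p + of_int n * r) + (of_int m * q + of_int n * t) * sqrt (of_int D)"
    by (simp add: x y algebra_simps)
  have "quad_conj D (of_int m *\<^sub>R x + of_int n *\<^sub>R y)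
    = (of_int m * p + of_int n * r) - (of_int m * q + of_int n * t) * sqrt (of_int D)"
    unfolding eq using rat by (intro quad_conj_eq[OF D]) auto
  moreover have "quad_conj D x = p - q * sqrt (of_int D)" "quad_conj D y = r - t * sqrt (of_int D)"
    unfolding x y using rat by (simp_all add: quad_conj_eq[OF D])
  ultimately show ?thesis by (simp add: psi_def) (simp add: algebra_simps)
qed

text \<open>The twist making \<open>x\<close> and \<open>y\<close> equally long has
  \<open>\<alpha>\<^sup>4 = (y'\<^sup>2 - x'\<^sup>2) / (x\<^sup>2 - y\<^sup>2)\<close>, which exists by the sign hypothesis.\<close>

lemma twists_by_exists:
  assumes D: "sqrt (of_int D) \<notin> \<rat>"
    and rat: "p \<in> \<rat>" "q \<in> \<rat>" "r \<in> \<rat>" "t \<in> \<rat>"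
    and x: "x = p + q * sqrt (of_int D)" and y: "y = r + t * sqrt (of_int D)"
    and x': "x' = p - q * sqrt (of_int D)" and y': "y' = r - t * sqrt (of_int D)"
    and basis: "int_basis I x y"
    and sign: "0 < (y'\<^sup>2 - x'\<^sup>2) * (x\<^sup>2 - y\<^sup>2)"
    and angle: "\<bar>x * x' + y * y'\<bar> \<le> 1 / 2 * \<bar>x * y' + x' * y\<bar>"
    and nz: "x * y' + x' * y \<noteq> 0"
  shows "\<exists>\<alpha>. twists_by D I x y \<alpha>"
proof -
  define a where "a = (y'\<^sup>2 - x'\<^sup>2) / (x\<^sup>2 - y\<^sup>2)"
  define \<alpha> where "\<alpha> = sqrt (sqrt a)"
  have a0: "a > 0" using sign by (auto simp: a_def zero_less_mult_iff zero_less_divide_iff)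
  then have \<alpha>: "\<alpha> > 0" by (simp add: \<alpha>_def)
  have "\<alpha> ^ 4 = (\<alpha>\<^sup>2)\<^sup>2" by simp
  also have "\<dots> = a" using a0 by (simp add: \<alpha>_def)
  finally have "\<alpha> ^ 4 * (x\<^sup>2 - y\<^sup>2) = y'\<^sup>2 - x'\<^sup>2" using sign by (auto simp: a_def)
  then have norms: "(\<alpha> * x)\<^sup>2 + (x' / \<alpha>)\<^sup>2 = (\<alpha> * y)\<^sup>2 + (y' / \<alpha>)\<^sup>2"
    using \<alpha> by (simp add: field_simps)
  have qx: "quad_conj D x = x'" and qy: "quad_conj D y = y'"
    unfolding x y x' y' using rat by (simp_all add: quad_conj_eq[OF D])
  let ?u = "twist \<alpha> (psi D x)" and ?v = "twist \<alpha> (psi D y)"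
  have u: "?u = (\<alpha> * x, x' / \<alpha>)" and v: "?v = (\<alpha> * y, y' / \<alpha>)"
    by (simp_all add: twist_def psi_def qx qy)
  have norm_u: "norm ?u = sqrt ((\<alpha> * x)\<^sup>2 + (x' / \<alpha>)\<^sup>2)"
    and norm_v: "norm ?v = sqrt ((\<alpha> * y)\<^sup>2 + (y' / \<alpha>)\<^sup>2)"
    by (simp_all add: u v norm_Pair power_divide)
  then have eq: "norm ?u = norm ?v" using norms by simp
  define N where "N = (\<alpha> * x)\<^sup>2 + (x' / \<alpha>)\<^sup>2"
  define P where "P = ?u \<bullet> ?v"
  have N0: "N \<ge> 0" by (simp add: N_def)
  have NN: "norm ?u * norm ?v = N" using N0 by (simp add: eq[symmetric] norm_u N_def)
  have "P = \<alpha>\<^sup>2 * x * y + x' * y' / \<alpha>\<^sup>2"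
    by (simp add: P_def u v power2_eq_square)
  \<comment> \<open>The two occurrences of \<open>N\<close> are expanded differently, the first as
    the squared length of the twisted \<open>x\<close> and the second as that of the twisted
    \<open>y\<close>. The result is a formula for the cosine \<open>P / N\<close> free of \<alpha>,
    to which the hypothesis \<open>angle\<close> applies.\<close>
  then have PS: "P * (x * y' + x' * y) = y * y' * N + x * x' * N"
    by (simp only:, subst N_def, subst N_def[unfolded norms])
      (use \<alpha> in \<open>simp add: field_simps power2_eq_square\<close>)
  have "P * (x * y' + x' * y) = (x * x' + y * y') * N"
    unfolding PS by (simp add: algebra_simps)
  then have "\<bar>P\<bar> * \<bar>x * y' + x' * y\<bar> = \<bar>x * x' + y * y'\<bar> * N"
    using N0 by (metis abs_mult abs_of_nonneg)
  also have "\<dots> \<le> 1 / 2 * \<bar>x * y' + x' * y\<bar> * N" by (intro mult_right_mono angle N0)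
  finally have "\<bar>P\<bar> * \<bar>x * y' + x' * y\<bar> \<le> (1 / 2 * N) * \<bar>x * y' + x' * y\<bar>"
    by (simp add: algebra_simps)
  then have "\<bar>P\<bar> \<le> 1 / 2 * N" using nz by simp
  then have "\<bar>?u \<bullet> ?v\<bar> \<le> 1 / 2 * norm ?u * norm ?v" using NN by (simp add: P_def)
  moreover have lin: "twist \<alpha> (psi D (of_int m *\<^sub>R x + of_int n *\<^sub>R y)) = of_int m *\<^sub>R ?u + of_int n *\<^sub>R ?v"
    for m n
    unfolding psi_int_combination[OF D rat x y] by (simp add: twist_def algebra_simps add_divide_distrib)
  have "int_basis (twist \<alpha> ` psi D ` I) ?u ?v"
  proof -
    have "twist \<alpha> ` psi D ` I = int_span ?u ?v"
      using basis int_span_image[of "\<lambda>z. twist \<alpha> (psi D z)" x y, OF lin]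
      by (simp add: int_basis_def image_image)
    moreover have "m = 0 \<and> n = 0" if "of_int m *\<^sub>R ?u + of_int n *\<^sub>R ?v = 0" for m n :: int
    proof -
      \<comment> \<open>The first coordinate alone gives independence, since there the twist only
        multiplies by \<alpha>.\<close>
      have "\<alpha> * (of_int m * x + of_int n * y) = 0"
        using that by (simp add: u v zero_prod_def algebra_simps)
      then have "of_int m *\<^sub>R x + of_int n *\<^sub>R y = 0" using \<alpha> by simp
      then show ?thesis using basis by (simp add: int_basis_def)
    qed
    ultimately show ?thesis by (auto simp: int_basis_def)
  qed
  ultimately have "minimal_basis (twist \<alpha> ` psi D ` I) ?u ?v"
    using eq by (simp add: minimal_basis_def)
  moreover from this have "well_rounded (twist \<alpha> ` psi D ` I)"
    by (rule minimal_basis_imp_well_rounded)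
  ultimately show ?thesis using \<alpha> by (auto simp: twists_by_def)
qed

section \<open>Arithmetic of admissible pairs and their modules\<close>

text \<open>A rational square root of an integer, in lowest terms, has denominator 1, and no square
  lies strictly between two consecutive squares.\<close>

lemma sqrt_int_irrational:
  fixes n D :: int
  assumes "n\<^sup>2 < D" "D < (n + 1)\<^sup>2" "0 \<le> n"
  shows "sqrt (of_int D) \<notin> \<rat>"
proof
  assume "sqrt (of_int D) \<in> \<rat>"
  then obtain a b :: int where ab: "b > 0" "coprime a b" "sqrt (of_int D) = of_int a / of_int b"
    by (rule Rats_cases') 
  have D0: "D \<ge> 0" using assms(1) by (smt (verit) zero_le_power2)
  have "(of_int D :: real) = (of_int a / of_int b)\<^sup>2"
    using D0 ab(3) by (metis of_int_0_le_iff real_sqrt_pow2)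
  then have "(of_int (D * b\<^sup>2) :: real) = of_int (a\<^sup>2)"
    using ab(1) by (simp add: field_simps)
  then have eq: "D * b\<^sup>2 = a\<^sup>2" by (simp only: of_int_eq_iff)
  then have "b\<^sup>2 dvd a\<^sup>2" by (metis dvd_triv_right)
  then have "b dvd a" by simp
  then have "is_unit b" using ab(2) by (metis coprime_absorb_left coprime_commute)
  then have "b = 1" using ab(1) by simp
  then have "D = \<bar>a\<bar>\<^sup>2" using eq by simp
  then have "n < \<bar>a\<bar>" "\<bar>a\<bar> < n + 1"
    using assms power_less_imp_less_base by (metis abs_ge_zero, metis add_nonneg_nonneg zero_le_one)
  then show False by linarith
qed

text \<open>The parity of \<open>b\<close> is read off the equation
  \<open>4 + b^2 + c^2 = 6 b c\<close>. The bound \<open>5 b \<le> c\<close> comes from rewriting it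
  as \<open>(c - 5 b) (c - b) = 4 (b^2 - 1) \<ge> 0\<close>, where \<open>b = c\<close> is excluded
  because it would force \<open>c = 1\<close>.\<close>

lemma admissible_pairs_facts:
  assumes "(b, c) \<in> admissible_pairs"
  shows "odd b" "1 \<le> b" "5 * b \<le> c" "c \<ge> 5"
    "(real b)\<^sup>2 + (real c)\<^sup>2 + 4 = 6 * real b * real c"
proof -
  have eq: "4 + b\<^sup>2 + c\<^sup>2 = 6 * b * c" and c: "odd c" "c > 1" "b \<le> c"
    using assms by (auto simp: admissible_pairs_def markoff_triple_def)
  have "even (4 + b\<^sup>2 + c\<^sup>2)" unfolding eq by simp
  then show "odd b" using c by simp
  then show b: "1 \<le> b" by (cases b) auto
  have eqi: "4 + (int b)\<^sup>2 + (int c)\<^sup>2 = 6 * int b * int c"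
    using arg_cong[OF eq, of int] by simp
  have "b \<noteq> c"
  proof
    assume "b = c"
    then have "4 = 4 * (int c)\<^sup>2" using eqi by (simp add: power2_eq_square)
    then have "int c = 1" by (simp add: power2_eq_1_iff)
    then show False using c by simp
  qed
  have "(int c - 5 * int b) * (int c - int b) = 4 * ((int b)\<^sup>2 - 1)"
    using eqi by (simp add: power2_eq_square algebra_simps)
  also have "\<dots> \<ge> 0" using b by simp
  finally have "int c - 5 * int b \<ge> 0" using c \<open>b \<noteq> c\<close> by (simp add: zero_le_mult_iff)
  then show "5 * b \<le> c" by simp
  then show "c \<ge> 5" using b by simp
  have "real (4 + b\<^sup>2 + c\<^sup>2) = real (6 * b * c)" by (simp only: eq)
  then show "(real b)\<^sup>2 + (real c)\<^sup>2 + 4 = 6 * real b * real c" by simp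
qed

text \<open>Both \<open>b\<close> and \<open>c\<close> are odd, so \<open>(b + c) / 2\<close> is an
  integer; it solves the congruence and is below \<open>c\<close> because
  \<open>b < c\<close>.\<close>

lemma markoff_k_eq:
  assumes "(b, c) \<in> admissible_pairs"
  shows "2 * markoff_k b c = int b + int c"
proof -
  note f = admissible_pairs_facts[OF assms]
  have c: "odd c" using assms by (simp add: admissible_pairs_def)
  have *: "2 * ((int b + int c) div 2) = int b + int c" using f(1) c by simp
  have "markoff_k b c = (int b + int c) div 2"
    unfolding markoff_k_def
    by (rule the1_equality[OF markoff_k_unique[OF c]]) (use f * in \<open>auto simp: cong_def\<close>)
  then show ?thesis using * by simp
qed

lemma markoff_gen_eq:
  assumes "(b, c) \<in> admissible_pairs"
  shows "markoff_gen b c = real b / 2 + real c + 1 / 2 * sqrt (of_int (markoff_disc c))"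
proof -
  have "2 * (of_int (markoff_k b c) :: real) = of_int (2 * markoff_k b c)" by simp
  also have "\<dots> = real b + real c" by (simp add: markoff_k_eq[OF assms])
  finally show ?thesis by (simp add: markoff_gen_def markoff_omega_def field_simps)
qed

lemma beta_eq:
  assumes "(b, c) \<in> admissible_pairs"
  shows "beta1 b c = -2" "beta2 b c = 0"
proof -
  note f = admissible_pairs_facts[OF assms]
  have k: "(of_int (markoff_k b c) :: real) = (real b + real c) / 2"
    using arg_cong[OF markoff_k_eq[OF assms], of real_of_int] by simp
  define s where "s = sqrt (3 * (real c)\<^sup>2 / 2 - 1)"
  have c: "real c \<ge> 5" "5 * real b \<le> real c" "real b \<ge> 1" using f by linarith+
  have c2: "(real c)\<^sup>2 \<ge> 5\<^sup>2" using c(1) by (intro power_mono) auto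
  have lo: "real c \<le> s"
    unfolding s_def by (rule real_le_rsqrt) (use c2 in simp)
  \<comment> \<open>Since \<open>5 b \<le> c\<close>, the integer \<open>k\<close> is at most
    \<open>3 c / 5\<close>, so the constant \<open>14 / 10\<close> gives \<open>k + s < 2 c\<close>,
    which is what \<beta>_1 = -2 requires.\<close>
  have hi: "s < 14 / 10 * real c"
    unfolding s_def by (rule real_less_lsqrt) (use c2 c(1) in \<open>simp_all add: power2_eq_square\<close>)
  show "beta1 b c = -2" "beta2 b c = 0"
    unfolding beta1_def beta2_def s_def[symmetric] k using c lo hi
    by (simp_all add: floor_eq_iff field_simps)
qed

text \<open>Irrationality holds because \<open>9 c^2 - 4\<close> lies strictly between
  \<open>(3 c - 1)^2\<close> and \<open>(3 c)^2\<close>. The bounds \<open>2 c\<close> and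
  \<open>3 c\<close> are coarse, but they suffice to compare \<open>y\<close> and its conjugate with
  \<open>c\<close>.\<close>

lemma sqrt_markoff_disc:
  assumes "c \<ge> 1"
  shows "sqrt (of_int (markoff_disc c)) \<notin> \<rat>"
    "sqrt (of_int (markoff_disc c)) < 3 * real c"
    "2 * real c \<le> sqrt (of_int (markoff_disc c))"
    "(sqrt (of_int (markoff_disc c)))\<^sup>2 = 9 * (real c)\<^sup>2 - 4"
proof -
  have D: "(of_int (markoff_disc c) :: real) = 9 * (real c)\<^sup>2 - 4" by (simp add: markoff_disc_def)
  have c2: "(real c)\<^sup>2 \<ge> 1" using assms by simp
  show "sqrt (of_int (markoff_disc c)) \<notin> \<rat>"
    by (rule sqrt_int_irrational[of "3 * int c - 1"])
      (use assms in \<open>simp_all add: markoff_disc_def power2_eq_square algebra_simps\<close>)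
  show "sqrt (of_int (markoff_disc c)) < 3 * real c"
    unfolding D by (rule real_less_lsqrt) (use c2 assms in \<open>simp_all add: power2_eq_square\<close>)
  show "2 * real c \<le> sqrt (of_int (markoff_disc c))"
    unfolding D by (rule real_le_rsqrt) (use c2 in \<open>simp add: power_mult_distrib\<close>)
  show "(sqrt (of_int (markoff_disc c)))\<^sup>2 = 9 * (real c)\<^sup>2 - 4"
    unfolding D using c2 by simp
qed

text \<open>Independence rests on the irrationality of sqrt D, which occurs in the generator with
  coefficient 1/2.\<close>

lemma int_basis_markoff_module:
  assumes "(b, c) \<in> admissible_pairs"
  shows "int_basis (markoff_module b c) (real c) (markoff_gen b c)"
proof -
  note f = admissible_pairs_facts[OF assms]
  let ?s = "sqrt (of_int (markoff_disc c))"
  have irr: "?s \<notin> \<rat>" using sqrt_markoff_disc f by simp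
  have "m = 0 \<and> n = 0" if "of_int m * real c + of_int n * markoff_gen b c = 0" for m n :: int
  proof -
    have "n = 0"
    proof (rule ccontr)
      assume n: "n \<noteq> 0"
      then have "?s = - 2 * of_int m * real c / of_int n - real b - 2 * real c"
        using that unfolding markoff_gen_eq[OF assms] by (simp add: field_simps)
      also have "\<dots> \<in> \<rat>" by simp
      finally show False using irr by simp
    qed
    then show ?thesis using that f by simp
  qed
  then show ?thesis by (simp add: int_basis_def markoff_module_def)
qed

section \<open>The two twists and their cosines\<close>

text \<open>The computation common to both bases, which differ only in \<open>J\<close>. The shift
  by 1 in \<open>J\<close> absorbs the summand \<open>c\<close> of \<open>markoff_gen b c\<close>.
  The hypothesis \<open>sign\<close> provides \<alpha>, while \<open>angle\<close> says that the
  cosine, after cancelling \<open>c\<close>, is at most 1/2 in absolute value.\<close>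

lemma markoff_twist:
  fixes j :: int
  defines "J \<equiv> of_int j + 1 :: real"
  assumes adm: "(b, c) \<in> admissible_pairs"
    and y: "y = of_int j * real c + markoff_gen b c"
    and y': "y' = real b / 2 + J * real c - 1 / 2 * sqrt (of_int (markoff_disc c))"
    and sign: "0 < (y'\<^sup>2 - (real c)\<^sup>2) * ((real c)\<^sup>2 - y\<^sup>2)"
    and nz: "real b + 2 * J * real c \<noteq> 0"
    and angle: "\<bar>(3 / 2 + J) * real b + (J\<^sup>2 - 3 / 2) * real c\<bar> \<le> 1 / 2 * \<bar>real b + 2 * J * real c\<bar>"
  shows "good_for_twisting (markoff_disc c) (markoff_module b c) {real c, y}"
    and "cos_theta (markoff_disc c) (markoff_module b c) {real c, y}
      = ((3 / 2 + J) * real b + (J\<^sup>2 - 3 / 2) * real c) / (real b + 2 * J * real c)"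
proof -
  note f = admissible_pairs_facts[OF adm]
  define s where "s = sqrt (of_int (markoff_disc c))"
  have "c \<ge> 1" using f by simp
  note D = sqrt_markoff_disc[OF this, folded s_def]
  note y' = y'[folded s_def]
  have ys: "y = (real b / 2 + J * real c) + 1 / 2 * s"
    unfolding y markoff_gen_eq[OF adm] by (simp add: J_def s_def algebra_simps)
  have basis: "int_basis (markoff_module b c) (real c) y"
    using int_basis_shear[OF int_basis_markoff_module[OF adm], of j] by (simp add: y)
  have prod: "y * y' = (real b / 2 + J * real c)\<^sup>2 - (9 * (real c)\<^sup>2 - 4) / 4"
    unfolding D(4)[symmetric] ys y' by (simp add: power2_eq_square algebra_simps)
  \<comment> \<open>The term \<open>b^2 / 4 + 1\<close> arising from the product is replaced by
    \<open>(6 b c - c^2) / 4\<close> through the Markoff equation, which makes \<open>c\<close> a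
    common factor.\<close>
  have num: "real c * real c + y * y' = real c * ((3 / 2 + J) * real b + (J\<^sup>2 - 3 / 2) * real c)"
    unfolding prod using f(5) by (simp add: power2_eq_square field_simps)
  have den: "real c * y' + real c * y = real c * (real b + 2 * J * real c)"
    by (simp add: ys y' algebra_simps)
  have Jrat: "J \<in> \<rat>" by (simp add: J_def)
  have "\<exists>\<alpha>. twists_by (markoff_disc c) (markoff_module b c) (real c) y \<alpha>"
  proof (rule twists_by_exists[where p = "real c" and q = 0 and x' = "real c" and y' = y'
        and r = "real b / 2 + J * real c" and t = "1 / 2"])
    show "\<bar>real c * real c + y * y'\<bar> \<le> 1 / 2 * \<bar>real c * y' + real c * y\<bar>"
      unfolding num den abs_mult using mult_left_mono[OF angle, of "real c"]
      by (simp add: algebra_simps)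
    show "real c * y' + real c * y \<noteq> 0" unfolding den using nz f by simp
  qed (use D(1) Jrat basis sign ys y' in \<open>simp_all add: s_def\<close>)
  then obtain \<alpha> where \<alpha>: "twists_by (markoff_disc c) (markoff_module b c) (real c) y \<alpha>" ..
  then show "good_for_twisting (markoff_disc c) (markoff_module b c) {real c, y}"
    using basis by (auto simp: good_for_twisting_def)
  have sub: "markoff_module b c \<subseteq> {u + v * sqrt (of_int (markoff_disc c)) | u v. u \<in> \<rat> \<and> v \<in> \<rat>}"
  proof
    fix z assume "z \<in> markoff_module b c"
    then obtain m n :: int where "z = of_int m * real c + of_int n * markoff_gen b c"
      by (auto simp: markoff_module_def int_span_def)
    then have "z = (of_int m * real c + of_int n * (real b / 2 + real c))
        + of_int n / 2 * sqrt (of_int (markoff_disc c))"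
      by (simp add: markoff_gen_eq[OF adm] algebra_simps)
    moreover have "of_int m * real c + of_int n * (real b / 2 + real c) \<in> \<rat>"
      "(of_int n / 2 :: real) \<in> \<rat>" by simp_all
    ultimately show "z \<in> {u + v * sqrt (of_int (markoff_disc c)) | u v. u \<in> \<rat> \<and> v \<in> \<rat>}" by blast
  qed
  have irr: "sqrt (of_int (markoff_disc c)) \<notin> \<rat>" using D(1) by (simp add: s_def)
  have qc: "quad_conj (markoff_disc c) (real c) = real c"
    using quad_conj_eq[OF irr, of "real c" 0] by simp
  have qy: "quad_conj (markoff_disc c) y = y'"
    unfolding ys y' s_def using Jrat by (intro quad_conj_eq[OF irr]) simp_all
  have "cos_theta (markoff_disc c) (markoff_module b c) {real c, y}
      = (real c * real c + y * y') / (real c * y' + real c * y)"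
    using cos_theta_eq[OF irr sub basis \<alpha>] by (simp add: qc qy)
  also have "\<dots> = ((3 / 2 + J) * real b + (J\<^sup>2 - 3 / 2) * real c) / (real b + 2 * J * real c)"
    unfolding num den using f by simp
  finally show "cos_theta (markoff_disc c) (markoff_module b c) {real c, y}
      = ((3 / 2 + J) * real b + (J\<^sup>2 - 3 / 2) * real c) / (real b + 2 * J * real c)" .
qed

text \<open>Here \<open>J = -1\<close>, and the bounds on sqrt D give
  \<open>\<bar>y\<bar> < c < \<bar>y'\<bar>\<close>, so both factors of \<open>sign\<close> are
  positive. The angle condition amounts to \<open>c - b \<le> 2 c - b\<close>.\<close>

lemma basis1_twist:
  assumes adm: "(b, c) \<in> admissible_pairs"
  shows "good_for_twisting (markoff_disc c) (markoff_module b c) (basis1 b c)"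
    and "cos_theta (markoff_disc c) (markoff_module b c) (basis1 b c)
      = (1 - real b / real c) / (2 * (2 - real b / real c))"
proof -
  note f = admissible_pairs_facts[OF adm]
  define s where "s = sqrt (of_int (markoff_disc c))"
  have c: "real c \<ge> 5" "5 * real b \<le> real c" "real b \<ge> 1" using f by linarith+
  have "c \<ge> 1" using f by simp
  note D = sqrt_markoff_disc[OF this, folded s_def]
  define y where "y = of_int (-2) * real c + markoff_gen b c"
  define y' where "y' = real b / 2 + (of_int (-2) + 1) * real c - 1 / 2 * s"
  have ys: "y = real b / 2 - real c + 1 / 2 * s"
    by (simp add: y_def markoff_gen_eq[OF adm] s_def)
  have "y\<^sup>2 < (real c)\<^sup>2"
    by (rule power2_strict_mono) (use c D ys in auto)
  moreover have "(real c)\<^sup>2 < y'\<^sup>2"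
    by (rule power2_strict_mono) (use c D in \<open>auto simp: y'_def\<close>)
  ultimately have sign: "0 < (y'\<^sup>2 - (real c)\<^sup>2) * ((real c)\<^sup>2 - y\<^sup>2)" by simp
  have B: "basis1 b c = {real c, y}" by (simp add: basis1_def beta_eq[OF adm] y_def)
  note * = markoff_twist[OF adm y_def y'_def[unfolded s_def] sign]
  show "good_for_twisting (markoff_disc c) (markoff_module b c) (basis1 b c)"
    unfolding B by (rule *(1)) (use c in \<open>auto simp: abs_if\<close>)
  have "cos_theta (markoff_disc c) (markoff_module b c) (basis1 b c)
      = (1 / 2 * real b - 1 / 2 * real c) / (real b - 2 * real c)"
    unfolding B by (subst *(2)) (use c in \<open>auto simp: abs_if\<close>)
  also have "\<dots> = (1 - real b / real c) / (2 * (2 - real b / real c))"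
    using c by (simp add: field_simps)
  finally show "cos_theta (markoff_disc c) (markoff_module b c) (basis1 b c)
      = (1 - real b / real c) / (2 * (2 - real b / real c))" .
qed

text \<open>Here \<open>J = 1\<close> and the order is reversed,
  \<open>\<bar>y'\<bar> < c < \<bar>y\<bar>\<close>, so both factors of \<open>sign\<close> are
  negative. The angle condition amounts to \<open>c - 5 b \<le> 2 c + b\<close>.\<close>

lemma basis2_twist:
  assumes adm: "(b, c) \<in> admissible_pairs"
  shows "good_for_twisting (markoff_disc c) (markoff_module b c) (basis2 b c)"
    and "cos_theta (markoff_disc c) (markoff_module b c) (basis2 b c)
      = (5 * (real b / real c) - 1) / (2 * (2 + real b / real c))"
proof -
  note f = admissible_pairs_facts[OF adm]
  define s where "s = sqrt (of_int (markoff_disc c))"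
  have c: "real c \<ge> 5" "5 * real b \<le> real c" "real b \<ge> 1" using f by linarith+
  have "c \<ge> 1" using f by simp
  note D = sqrt_markoff_disc[OF this, folded s_def]
  define y where "y = of_int 0 * real c + markoff_gen b c"
  define y' where "y' = real b / 2 + (of_int 0 + 1) * real c - 1 / 2 * s"
  have ys: "y = real b / 2 + real c + 1 / 2 * s"
    by (simp add: y_def markoff_gen_eq[OF adm] s_def)
  have "(real c)\<^sup>2 < y\<^sup>2"
    by (rule power2_strict_mono) (use c D ys in auto)
  moreover have "y'\<^sup>2 < (real c)\<^sup>2"
    by (rule power2_strict_mono) (use c D in \<open>auto simp: y'_def\<close>)
  ultimately have sign: "0 < (y'\<^sup>2 - (real c)\<^sup>2) * ((real c)\<^sup>2 - y\<^sup>2)"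
    by (simp add: mult_neg_neg)
  have B: "basis2 b c = {real c, y}" by (simp add: basis2_def beta_eq[OF adm] y_def)
  note * = markoff_twist[OF adm y_def y'_def[unfolded s_def] sign]
  show "good_for_twisting (markoff_disc c) (markoff_module b c) (basis2 b c)"
    unfolding B by (rule *(1)) (use c in \<open>auto simp: abs_if\<close>)
  have "cos_theta (markoff_disc c) (markoff_module b c) (basis2 b c)
      = (5 / 2 * real b - 1 / 2 * real c) / (real b + 2 * real c)"
    unfolding B by (subst *(2)) (use c in \<open>auto simp: abs_if\<close>)
  also have "\<dots> = (5 * (real b / real c) - 1) / (2 * (2 + real b / real c))"
    using c by (simp add: divide_simps)
  finally show "cos_theta (markoff_disc c) (markoff_module b c) (basis2 b c)
      = (5 * (real b / real c) - 1) / (2 * (2 + real b / real c))" .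
qed

section \<open>Limits of the cosines\<close>

text \<open>As a quadratic in \<open>b\<close>, the Markoff equation has roots
  \<open>3 c \<plusminus> sqrt (8 c^2 - 4)\<close>; the inequality \<open>b \<le> 3 c\<close>
  selects the smaller one.\<close>

lemma admissible_pairs_smaller_eq:
  assumes "(b, c) \<in> admissible_pairs"
  shows "real b = 3 * real c - sqrt (8 * (real c)\<^sup>2 - 4)"
proof -
  note f = admissible_pairs_facts[OF assms]
  have "(3 * real c - real b)\<^sup>2 = 8 * (real c)\<^sup>2 - 4"
    using f(5) by (simp add: power2_eq_square algebra_simps)
  moreover have "3 * real c - real b \<ge> 0" using f by linarith
  ultimately have "sqrt (8 * (real c)\<^sup>2 - 4) = 3 * real c - real b"
    by (metis real_sqrt_unique)
  then show ?thesis by simp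
qed

text \<open>The filter expresses that \<open>c\<close> tends to infinity along admissible pairs. On
  these pairs \<open>b / c\<close> is a function of \<open>c\<close> alone, so the limit reduces to
  one real variable.\<close>

lemma tendsto_admissible_pairs:
  assumes f: "\<And>b c. (b, c) \<in> admissible_pairs \<Longrightarrow> f (b, c) = g (real b / real c)"
    and g: "isCont g (3 - 2 * sqrt 2)" "g (3 - 2 * sqrt 2) = l"
  shows "(f \<longlongrightarrow> l) (inf (filtercomap snd at_top) (principal admissible_pairs))"
proof -
  let ?F = "inf (filtercomap snd at_top) (principal admissible_pairs)"
  let ?r = "\<lambda>x::real. (3 * x - sqrt (8 * x\<^sup>2 - 4)) / x"
  have "sqrt 8 = 2 * sqrt 2" using real_sqrt_mult[of 4 2] by simp
  moreover have "(?r \<longlongrightarrow> 3 - sqrt 8) at_top"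
    by (real_asymp simp add: powr_half_sqrt)
  ultimately have r: "(?r \<longlongrightarrow> 3 - 2 * sqrt 2) at_top" by simp
  have "filterlim snd at_top ?F"
    by (rule filterlim_mono[OF filterlim_filtercomap]) auto
  then have "((\<lambda>p. g (?r (real (snd p)))) \<longlongrightarrow> g (3 - 2 * sqrt 2)) ?F"
    by (intro isCont_tendsto_compose[OF g(1)] filterlim_compose[OF r]
        filterlim_compose[OF filterlim_real_sequentially])
  moreover have "\<forall>\<^sub>F p in ?F. g (?r (real (snd p))) = f p"
    unfolding eventually_inf_principal using f
    by (intro always_eventually) (auto simp flip: admissible_pairs_smaller_eq)
  ultimately show ?thesis unfolding g(2) by (rule Lim_transform_eventually)
qed

section \<open>Pell numbers and Vieta moves\<close>

text \<open>Obtained by eliminating the odd-indexed terms from the recurrence. The right-hand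
  coefficient 6 matches the sum of roots in the Vieta move. The case \<open>n = 1\<close> relies on
  the extension \<open>pell 0 = 1\<close>.\<close>

lemma pell_even_step: "n \<ge> 1 \<Longrightarrow> pell (2 * n + 2) + pell (2 * n - 2) = 6 * pell (2 * n)"
  by (cases n) (simp_all add: numeral_eq_Suc)

text \<open>Induction from \<open>(1, 5)\<close> by the Vieta move: for fixed \<open>b\<close>, the
  numbers \<open>a\<close> and \<open>c = 6 b - a\<close> are the two roots of
  \<open>x^2 - 6 b x + b^2 + 4\<close>.\<close>

lemma pell_admissible: "n \<ge> 2 \<Longrightarrow> (pell (2 * n - 2), pell (2 * n)) \<in> admissible_pairs"
proof (induction n rule: dec_induct)
  case base
  have "pell 2 = 1" "pell 4 = 5" by (simp_all add: numeral_eq_Suc)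
  then show ?case by (simp add: admissible_pairs_def markoff_triple_def)
next
  case (step n)
  define a b c where "a = pell (2 * n - 2)" and "b = pell (2 * n)" and "c = pell (2 * n + 2)"
  have rec: "c + a = 6 * b" using pell_even_step[of n] step(1)
    by (simp add: a_def b_def c_def)
  have IH: "(a, b) \<in> admissible_pairs" using step.IH by (simp add: a_def b_def)
  note f = admissible_pairs_facts[OF IH]
  have ab: "odd b" "4 + a\<^sup>2 + b\<^sup>2 = 6 * a * b"
    using IH by (auto simp: admissible_pairs_def markoff_triple_def)
  have "odd (c + a)  = odd (6 * b)" using rec by simp
  then have "odd c" using f by simp
  moreover have "4 + b\<^sup>2 + c\<^sup>2 = 6 * b * c"
  proof -
    have c: "int c = 6 * int b - int a" using rec by linarith
    have "4 + (int a)\<^sup>2 + (int b)\<^sup>2 = 6 * int a * int b"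
      using arg_cong[OF ab(2), of int] by simp
    then have "4 + (int b)\<^sup>2 + (int c)\<^sup>2 = 6 * int b * int c"
      unfolding c by (simp add: power2_eq_square algebra_simps)
    then have "int (4 + b\<^sup>2 + c\<^sup>2) = int (6 * b * c)" by simp
    then show ?thesis by (simp only: of_nat_eq_iff)
  qed
  moreover have "b \<le> c" "c > 1" using rec f by linarith+
  ultimately have "(b, c) \<in> admissible_pairs"
    by (simp add: admissible_pairs_def markoff_triple_def)
  then show ?case by (simp add: b_def c_def)
qed

text \<open>Vieta descent: for \<open>b > 1\<close> the triple \<open>(2, b, c)\<close> is replaced by \<open>(2, 6 b - c, b)\<close>.\<close>

lemma admissible_imp_pell:
  "(b, c) \<in> admissible_pairs \<Longrightarrow> \<exists>n\<ge>2. b = pell (2 * n - 2) \<and> c = pell (2 * n)"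
proof (induction c arbitrary: b rule: less_induct)
  case (less c)
  note f = admissible_pairs_facts[OF less.prems]
  have eq: "4 + b\<^sup>2 + c\<^sup>2 = 6 * b * c"
    using less.prems by (auto simp: admissible_pairs_def markoff_triple_def)
  have eqi: "4 + (int b)\<^sup>2 + (int c)\<^sup>2 = 6 * int b * int c"
    using arg_cong[OF eq, of int] by simp
  show ?case
  proof (cases "b = 1")
    case True
    then have "(int c - 5) * (int c - 1) = 0"
      using eqi by (simp add: power2_eq_square algebra_simps)
    then have "c = 5" using f by auto
    then show ?thesis using True by (intro exI[of _ 2]) (simp add: numeral_eq_Suc)
  next
    case False
    \<comment> \<open>This makes the natural-number subtraction in \<open>a = 6 * b - c\<close>
      exact.\<close>
    have "c * c \<le> (6 * b) * c" using eq unfolding power2_eq_square by linarith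
    then have "c \<le> 6 * b" using f by simp
    define a where "a = 6 * b - c"
    have a: "c + a = 6 * b" using \<open>c \<le> 6 * b\<close> by (simp add: a_def)
    have ai: "int a = 6 * int b - int c" using a by linarith
    have "4 + (int a)\<^sup>2 + (int b)\<^sup>2 = 6 * int a * int b"
      unfolding ai using eqi by (simp add: power2_eq_square algebra_simps)
    then have "int (4 + a\<^sup>2 + b\<^sup>2) = int (6 * a * b)" by simp
    then have "4 + a\<^sup>2 + b\<^sup>2 = 6 * a * b" by (simp only: of_nat_eq_iff)
    \<comment> \<open>The descent stays among ordered pairs because
      \<open>5 b \<le> c\<close>.\<close>
    moreover have "a \<le> b" "b > 1" using a f False by linarith+
    ultimately have "(a, b) \<in> admissible_pairs"
      using f(1) by (simp add: admissible_pairs_def markoff_triple_def)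
    moreover have "b < c" using f by linarith
    ultimately obtain n where n: "n \<ge> 2" "a = pell (2 * n - 2)" "b = pell (2 * n)"
      using less.IH by blast
    have "pell (2 * n + 2) + a = 6 * b"
      using pell_even_step[of n] n by simp
    then have "c = pell (2 * n + 2)" using a by linarith
    then show ?thesis using n by (intro exI[of _ "Suc n"]) simp
  qed
qed

lemma admissible_pairs_eq_pell:
  "admissible_pairs = {(pell (2 * n - 2), pell (2 * n)) | n. n \<ge> 2}"
  using pell_admissible admissible_imp_pell by fast

text \<open>The bound \<open>5 b \<le> c\<close>, applied to consecutive Pell pairs, makes the
  values of \<open>c\<close> unbounded; this also keeps the limits in the theorem from being
  vacuous.\<close>

lemma infinite_admissible_pairs: "infinite admissible_pairs"
proof
  assume "finite admissible_pairs"
  then have fin: "finite (snd ` admissible_pairs)" by simp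
  have grow: "n < pell (2 * n)" if "n \<ge> 2" for n
    using that
  proof (induction n rule: dec_induct)
    case base
    show ?case by (simp add: numeral_eq_Suc)
  next
    case (step n)
    have "5 * pell (2 * n) \<le> pell (2 * n + 2)"
      using admissible_pairs_facts(3)[OF pell_admissible[of "Suc n"]] step(1) by simp
    then show ?case using step.IH by simp
  qed
  obtain m where m: "\<And>c. c \<in> snd ` admissible_pairs \<Longrightarrow> c < m"
    using fin unfolding finite_nat_set_iff_bounded by blast
  have "pell (2 * (m + 2)) \<in> snd ` admissible_pairs"
    using pell_admissible[of "m + 2"] by (metis image_eqI le_add2 snd_conv)
  then have "pell (2 * (m + 2)) < m" by (rule m)
  then show False using grow[of "m + 2"] by simp
qed

theorem theorem6p7:
  shows "(\<forall>b c. markoff_triple 2 b c \<and> odd c \<and> c > 1 \<and> b \<le> c \<longrightarrow>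
      beta1 b c = -2 \<and> beta2 b c = 0 \<and>
      basis1 b c = {real c,
        -2 * real c + of_int (markoff_k b c) + (real c - 1) / 2 + markoff_omega c} \<and>
      basis2 b c = {real c,
        of_int (markoff_k b c) + (real c - 1) / 2 + markoff_omega c} \<and>
      good_for_twisting (markoff_disc c) (markoff_module b c) (basis1 b c) \<and>
      good_for_twisting (markoff_disc c) (markoff_module b c) (basis2 b c)) \<and>
    ((\<lambda>(b, c). cos_theta (markoff_disc c) (markoff_module b c) (basis1 b c))
           \<longlongrightarrow> (3 - sqrt 2) / 7)
         (inf (filtercomap snd at_top) (principal admissible_pairs)) \<and>
    ((\<lambda>(b, c). cos_theta (markoff_disc c) (markoff_module b c) (basis2 b c))
           \<longlongrightarrow> (15 - 11 * sqrt 2) / 17)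
         (inf (filtercomap snd at_top) (principal admissible_pairs)) \<and>
    infinite {(b, c). markoff_triple 2 b c \<and> odd c} \<and>
    admissible_pairs = {(pell (2 * n - 2), pell (2 * n)) | n. n \<ge> 2}"
proof (intro conjI allI impI)
  fix b c assume "markoff_triple 2 b c \<and> odd c \<and> c > 1 \<and> b \<le> c"
  then have adm: "(b, c) \<in> admissible_pairs" by (simp add: admissible_pairs_def)
  show "beta1 b c = -2" "beta2 b c = 0" by (fact beta_eq[OF adm])+
  then show "basis1 b c = {real c,
        -2 * real c + of_int (markoff_k b c) + (real c - 1) / 2 + markoff_omega c}"
    "basis2 b c = {real c, of_int (markoff_k b c) + (real c - 1) / 2 + markoff_omega c}"
    by (simp_all add: basis1_def basis2_def markoff_gen_def algebra_simps)
  show "good_for_twisting (markoff_disc c) (markoff_module b c) (basis1 b c)"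
    "good_for_twisting (markoff_disc c) (markoff_module b c) (basis2 b c)"
    by (fact basis1_twist(1)[OF adm] basis2_twist(1)[OF adm])+
next
  \<comment> \<open>At the limiting ratio \<open>2 - r\<close> equals \<open>2 sqrt 2 - 1\<close>,
    of absolute norm 7, the denominator of the limit.\<close>
  have "1 < sqrt 2" by simp
  then have nz: "2 - (3 - 2 * sqrt 2) \<noteq> 0" by linarith
  show "((\<lambda>(b, c). cos_theta (markoff_disc c) (markoff_module b c) (basis1 b c))
      \<longlongrightarrow> (3 - sqrt 2) / 7) (inf (filtercomap snd at_top) (principal admissible_pairs))"
  proof (rule tendsto_admissible_pairs)
    show "isCont (\<lambda>r. (1 - r) / (2 * (2 - r))) (3 - 2 * sqrt 2)" using nz by (intro continuous_intros) auto
    show "(1 - (3 - 2 * sqrt 2)) / (2 * (2 - (3 - 2 * sqrt 2))) = (3 - sqrt 2) / 7" using nz by (simp add: field_simps)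
  qed (simp add: basis1_twist(2))
next
  \<comment> \<open>Here \<open>2 + r\<close> equals \<open>5 - 2 sqrt 2\<close>, of norm
    17.\<close>
  have "sqrt 2 < 2" by (rule real_less_lsqrt) auto
  then have nz: "2 + (3 - 2 * sqrt 2) \<noteq> 0" by linarith
  show "((\<lambda>(b, c). cos_theta (markoff_disc c) (markoff_module b c) (basis2 b c))
      \<longlongrightarrow> (15 - 11 * sqrt 2) / 17) (inf (filtercomap snd at_top) (principal admissible_pairs))"
  proof (rule tendsto_admissible_pairs)
    show "isCont (\<lambda>r. (5 * r - 1) / (2 * (2 + r))) (3 - 2 * sqrt 2)" using nz by (intro continuous_intros) auto
    show "(5 * (3 - 2 * sqrt 2) - 1) / (2 * (2 + (3 - 2 * sqrt 2))) = (15 - 11 * sqrt 2) / 17" using nz by (simp add: field_simps)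
  qed (simp add: basis2_twist(2))
next
  show "infinite {(b, c). markoff_triple 2 b c \<and> odd c}"
    by (rule infinite_super[OF _ infinite_admissible_pairs]) (auto simp: admissible_pairs_def)
  show "admissible_pairs = {(pell (2 * n - 2), pell (2 * n)) | n. n \<ge> 2}"
    by (rule admissible_pairs_eq_pell)
qed

end
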